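(* Let $q>0$ be an integer, let $X$ be a $(q+1)$-regular graph, and fix a base vertex $x_0$ of $X$. For $m\ge 0$ and a vertex $x$, let $c_m(x)$ be the number of geodesics of length $m$ from $x_0$ to $x$, and put $$b_m(x)=c_m(x)-(q-1)\bigl(c_{m-2}(x)+c_{m-4}(x)+\cdots\bigr),$$ where the last term in the parenthesis is $c_1(x)$ if $m$ is odd and $c_0(x)$ if $m$ is even (so $b_0(x)=c_0(x)$ and $b_1(x)=c_1(x)$). Then the heat kernel of $X$ is given, for all $t\ge 0$ and all vertices $x$, by $$K_X(t,x_0,x)=e^{-(q+1)t}\sum_{m=0}^{\infty} b_m(x)\,q^{-m/2}\,I_m(2\sqrt{q}\,t),$$ where $I_m$ is the $I$-Bessel function of order $m$.
   Context: A graph $X$ consists of a set $VX$ of vertices, a set $EX$ of (oriented) edges, maps $o,t:EX\to VX$ (origin and terminus), and a map $y\mapsto\overline{y}$ on $EX$ with $\overline{\overline{y}}=y$, $\overline{y}\ne y$, $o(y)=t(\overline{y})$ for all $y\in EX$ (loops and multiple edges are allowed). The degree of a vertex $x$ is the number of $y\in EX$ with $o(y)=x$; $X$ is $d$-regular if every vertex has degree $d$. The graph may be finite or infinite. A path of length $n$ is a sequence of edges $y_0,\dots,y_{n-1}$ with $t(y_i)=o(y_{i+1})$ (a path of length $0$ is a vertex); it has backtracking if $y_{i+1}=\overline{y_i}$ for some $i$. A geodesic is a path without backtracking. Thus $c_0(x)$ is $1$ if $x=x_0$ and $0$ otherwise. The Laplacian on functions $f:VX\to\mathbb{R}$ is $\Delta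 f(x)=(q+1)f(x)-\sum_{e:\,o(e)=x} f(t(e))$. The heat kernel $K_X(t,x_0,x)$, $t\ge 0$, is the unique bounded solution of $\Delta K_X(t,x_0,x)+\frac{\partial}{\partial t}K_X(t,x_0,x)=0$ (with $\Delta$ acting in the variable $x$), $K_X(0,x_0,x)=1$ if $x=x_0$ and $0$ otherwise. For an integer $m\ge0$, $I_m(t)=\sum_{n=0}^\infty \frac{(t/2)^{2n+m}}{n!\,\Gamma(n+1+m)}$. *)

theory Defs
  imports "HOL-Analysis.Analysis" "Graph_Theory.Bidirected_Digraph" "Graph_Theory.Arc_Walk"
begin

text \<open>
  Graphs with oriented edges, loops and multiple edges are rendered by the locale
  \<^locale>\<open>bidirected_digraph\<close>: \<^const>\<open>tail\<close> and \<^const>\<open>head\<close> are the origin and terminus maps, and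
  the function \<open>arev\<close> below is the fixed-point-free edge reversal (extended by the identity to
  values of the edge type that are not edges). Neither the vertex set nor the edge set need be
  finite, and the graph need not be connected.
\<close>

text \<open>
  An infinite out-neighbourhood has \<^const>\<open>out_degree\<close> 0, so \<open>regular_graph X d\<close> forces local
  finiteness only for \<open>d > 0\<close>.
\<close>
definition regular_graph :: "('v, 'e) pre_digraph \<Rightarrow> nat \<Rightarrow> bool" where
  "regular_graph X d \<longleftrightarrow> (\<forall>x \<in> verts X. out_degree X x = d)"

definition backtracks :: "('e \<Rightarrow> 'e) \<Rightarrow> 'e list \<Rightarrow> bool" where
  "backtracks arev p \<longleftrightarrow> (\<exists>i. Suc i < length p \<and> p ! Suc i = arev (p ! i))"

definition geodesic ::
    "('v, 'e) pre_digraph \<Rightarrow> ('e \<Rightarrow> 'e) \<Rightarrow> 'v \<Rightarrow> 'e list \<Rightarrow> 'v \<Rightarrow> bool" where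
  "geodesic X arev u p v \<longleftrightarrow> pre_digraph.awalk X u p v \<and> \<not> backtracks arev p"

definition geodesic_count ::
    "('v, 'e) pre_digraph \<Rightarrow> ('e \<Rightarrow> 'e) \<Rightarrow> 'v \<Rightarrow> nat \<Rightarrow> 'v \<Rightarrow> nat" where
  "geodesic_count X arev x0 m x = card {p. geodesic X arev x0 p x \<and> length p = m}"

text \<open>
  The indices \<open>m - 2 * j\<close> run over \<open>m - 2, m - 4, \<dots>\<close> down to 0 or 1; for \<open>m < 2\<close> the sum is empty.
\<close>
definition geodesic_coeff ::
    "nat \<Rightarrow> ('v, 'e) pre_digraph \<Rightarrow> ('e \<Rightarrow> 'e) \<Rightarrow> 'v \<Rightarrow> nat \<Rightarrow> 'v \<Rightarrow> real" where
  "geodesic_coeff q X arev x0 m x =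
     real (geodesic_count X arev x0 m x)
       - (real q - 1) * (\<Sum>j = 1..m div 2. real (geodesic_count X arev x0 (m - 2 * j) x))"

definition laplacian ::
    "nat \<Rightarrow> ('v, 'e) pre_digraph \<Rightarrow> ('v \<Rightarrow> real) \<Rightarrow> 'v \<Rightarrow> real" where
  "laplacian q X f x = (real q + 1) * f x - (\<Sum>e \<in> out_arcs X x. f (head X e))"

text \<open>
  Bounded solutions of the heat equation on \<open>[0, \<infinity>) \<times> V\<close> started at the point mass at \<open>x0\<close>,
  with a one-sided time derivative at 0. Values of \<open>K\<close> at negative times or outside the
  vertex set are unconstrained.
\<close>
definition is_heat_kernel ::
    "nat \<Rightarrow> ('v, 'e) pre_digraph \<Rightarrow> 'v \<Rightarrow> (real \<Rightarrow> 'v \<Rightarrow> real) \<Rightarrow> bool" where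
  "is_heat_kernel q X x0 K \<longleftrightarrow>
     (\<forall>t \<ge> 0. \<forall>x \<in> verts X.
        \<exists>D. ((\<lambda>s. K s x) has_real_derivative D) (at t within {0..})
          \<and> laplacian q X (K t) x + D = 0)
     \<and> (\<forall>x \<in> verts X. K 0 x = (if x = x0 then 1 else 0))
     \<and> (\<exists>B. \<forall>t \<ge> 0. \<forall>x \<in> verts X. \<bar>K t x\<bar> \<le> B)"

definition bessel_I :: "nat \<Rightarrow> real \<Rightarrow> real" where
  "bessel_I m t = (\<Sum>n. (t / 2) ^ (2 * n + m) / (fact n * Gamma (real (n + 1 + m))))"

end

theory Submission
  imports Defs
begin

text \<open>
  Write \<open>A\<close> for the adjacency operator, \<open>A f x = \<Sum>f (head e)\<close> over the edges \<open>e\<close> leaving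
  \<open>x\<close>. Every vertex has exactly \<open>q + 1\<close> such edges, so \<open>\<Delta> = (q + 1) - A\<close>, \<open>A\<close> is bounded by
  \<open>q + 1\<close> in the supremum norm, and the heat kernel is \<open>e\<^sup>-\<^sup>(\<^sup>q\<^sup>+\<^sup>1\<^sup>)\<^sup>t \<Sum>\<^sub>N A\<^sup>N \<delta> t\<^sup>N / N!\<close>, where
  \<open>\<delta>\<close> is the point mass at the base vertex. It is the only bounded solution because a bounded
  solution \<open>L\<close> with \<open>L 0 = 0\<close> satisfies \<open>\<bar>L\<bar> \<le> B (C t)\<^sup>n / n!\<close> for every \<open>n\<close>, with
  \<open>C = 2 (q + 1)\<close>: integrate the bound for \<open>n\<close> to get the one for \<open>n + 1\<close>.
  
  What remains is the identity between this series and the Bessel series. Prolonging a geodesic by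
  one edge either gives a longer geodesic or cancels its last edge, and so
  \<open>A c\<^sub>m = c\<^sub>m\<^sub>+\<^sub>1 + q c\<^sub>m\<^sub>-\<^sub>1\<close> for \<open>m \<ge> 2\<close>, with \<open>q + 1\<close> in place of \<open>q\<close> for \<open>m = 1\<close>.
  The corrected coefficients \<open>b\<^sub>m\<close> are made to absorb this exception:
  \<open>A b\<^sub>m = b\<^sub>m\<^sub>+\<^sub>1 + q b\<^sub>m\<^sub>-\<^sub>1\<close> for \<open>m \<ge> 2\<close>, \<open>A b\<^sub>1 = b\<^sub>2 + 2 q b\<^sub>0\<close> and \<open>A b\<^sub>0 = b\<^sub>1\<close>.
  These are the relations satisfied by the values at \<open>m \<ge> 0\<close> of a two-sided solution \<open>\<beta>\<close> of
  \<open>A \<beta>\<^sub>k = \<beta>\<^sub>k\<^sub>+\<^sub>1 + q \<beta>\<^sub>k\<^sub>-\<^sub>1\<close> that is symmetric up to scaling, \<open>\<beta>\<^sub>-\<^sub>k = q\<^sup>-\<^sup>k \<beta>\<^sub>k\<close>, with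
  \<open>\<beta>\<^sub>0 = 2 b\<^sub>0\<close> (lemma \<open>adj_reflected_geod_coeff\<close>). On a two-sided sequence \<open>A\<close> is a sum of two
  commuting shifts, so the binomial theorem gives
  \<open>2 A\<^sup>N \<delta> = A\<^sup>N \<beta>\<^sub>0 = \<Sum>\<^sub>n (N choose n) q\<^sup>n \<beta>\<^sub>N\<^sub>-\<^sub>2\<^sub>n\<close>, and folding the sum at its middle yields
  \<open>A\<^sup>N \<delta> = \<Sum>(N choose n) q\<^sup>n b\<^sub>N\<^sub>-\<^sub>2\<^sub>n\<close> over \<open>2 n \<le> N\<close> (lemma \<open>walk_count_eq\<close>).
  
  On the other side, \<open>q\<^sup>-\<^sup>m\<^sup>/\<^sup>2 I\<^sub>m(2 \<surd>q t) = \<Sum>\<^sub>n q\<^sup>n t\<^sup>2\<^sup>n\<^sup>+\<^sup>m / (n! (n + m)!)\<close>. Collecting the terms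
  with \<open>2 n + m = N\<close> in the resulting double series gives exactly \<open>A\<^sup>N \<delta> t\<^sup>N / N!\<close>. The
  rearrangement is legitimate because \<open>\<bar>b\<^sub>m\<bar> \<le> (3 q + 1)\<^sup>m\<close>, which makes the double series
  absolutely convergent (lemma \<open>rearrange_bessel_series\<close>).
\<close>

section \<open>Rearranging a series of Bessel functions\<close>

text \<open>
  The two halves of a sum over \<open>{..N}\<close> that is symmetric under \<open>n \<mapsto> N - n\<close> agree. For even
  \<open>N\<close> the middle term belongs to both halves, which is why it must be doubled in \<open>g\<close>.
\<close>
lemma fold_reflected_sum:
  fixes g h :: "nat \<Rightarrow> 'a::comm_monoid_add"
  assumes "\<And>n. 2 * n < N \<Longrightarrow> g n = h n"
    and "\<And>n. 2 * n = N \<Longrightarrow> g n = h n + h n"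
    and "\<And>n. N < 2 * n \<Longrightarrow> n \<le> N \<Longrightarrow> g n = h (N - n)"
  shows "(\<Sum>n\<le>N. g n) = (\<Sum>n\<in>{n. 2 * n \<le> N}. h n) + (\<Sum>n\<in>{n. 2 * n \<le> N}. h n)"
proof -
  have half: "{n \<in> {..N}. 2 * n \<le> N} = {n. 2 * n \<le> N}" by auto
  have "(\<Sum>n\<le>N. g n)
      = (\<Sum>n\<le>N. (if 2 * n \<le> N then h n else 0) + (if 2 * (N - n) \<le> N then h (N - n) else 0))"
  proof (rule sum.cong[OF refl])
    fix n assume "n \<in> {..N}"
    moreover have "N - n = n" if "2 * n = N" using that by simp
    ultimately show "g n
        = (if 2 * n \<le> N then h n else 0) + (if 2 * (N - n) \<le> N then h (N - n) else 0)"
      using assms by (cases "2 * n" N rule: linorder_cases) auto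
  qed
  also have "\<dots> = (\<Sum>n\<le>N. if 2 * n \<le> N then h n else 0)
      + (\<Sum>n\<le>N. if 2 * (N - n) \<le> N then h (N - n) else 0)"
    by (rule sum.distrib)
  also have "(\<Sum>n\<le>N. if 2 * (N - n) \<le> N then h (N - n) else 0)
      = (\<Sum>n\<le>N. if 2 * n \<le> N then h n else 0)"
    by (rule sum.reindex_bij_witness[of _ "\<lambda>n. N - n" "\<lambda>n. N - n"]) auto
  finally show ?thesis
    by (simp only: sum.inter_filter[OF finite_atMost, symmetric] half)
qed

lemma scaled_bessel_term:
  assumes "q > 0"
  shows "real q powr (- real m / 2) * (sqrt (real q) * t) ^ (2 * n + m) = real q ^ n * t ^ (2 * n + m)"
proof -
  have "real q powr (- real m / 2) = 1 / sqrt (real q) ^ m"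
    using assms by (simp add: powr_minus_divide powr_half_sqrt_powr powr_realpow real_sqrt_power)
  moreover have "sqrt (real q) ^ (2 * n + m) = real q ^ n * sqrt (real q) ^ m"
    by (simp add: power_add power_mult)
  ultimately show ?thesis
    using assms by (simp add: power_mult_distrib)
qed

lemma summable_exp_terms: "summable (\<lambda>n. x ^ n / fact n :: real)"
  using summable_exp[of x] by (simp add: field_simps)

text \<open>
  The double series in \<open>m\<close> and \<open>n\<close> behind the left-hand side is dominated by the product of two
  exponential series, since \<open>(n + m)! \<ge> m!\<close>. It may therefore be summed along the lines
  \<open>2 n + m = N\<close> instead, where \<open>1 / (n! (N - n)!)\<close> turns into a binomial coefficient over
  \<open>N!\<close>.
\<close>
lemma rearrange_bessel_series:
  fixes b :: "nat \<Rightarrow> real" and q :: nat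
  assumes q: "q > 0" and R: "\<And>m. \<bar>b m\<bar> \<le> R ^ m"
  shows "(\<lambda>m. b m * real q powr (- real m / 2) * bessel_I m (2 * sqrt (real q) * t)) sums
    (\<Sum>N. (\<Sum>n\<in>{n. 2 * n \<le> N}. real (N choose n) * real q ^ n * b (N - 2 * n)) / fact N * t ^ N)"
proof -
  define f where
    "f = (\<lambda>(m, n). b m * (real q ^ n * t ^ (2 * n + m)) / (fact n * fact (n + m)))"
  define M where
    "M = (\<lambda>(m, n). (R * \<bar>t\<bar>) ^ m / fact m * ((real q * t\<^sup>2) ^ n / fact n))"
  define w where
    "w = (\<lambda>N. \<Sum>n\<in>{n. 2 * n \<le> N}. real (N choose n) * real q ^ n * b (N - 2 * n))"
  have R0: "R \<ge> 0" using R[of 1] by simp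
  have "M summable_on UNIV \<times> UNIV"
  proof (rule summable_on_SigmaI)
    fix m :: nat
    have "(\<lambda>n. (real q * t\<^sup>2) ^ n / fact n) sums exp (real q * t\<^sup>2)"
      using exp_converges[of "real q * t\<^sup>2"] by (simp add: field_simps)
    then have "((\<lambda>n. (real q * t\<^sup>2) ^ n / fact n) has_sum exp (real q * t\<^sup>2)) UNIV"
      by (rule sums_nonneg_imp_has_sum) simp
    then show "((\<lambda>n. M (m, n)) has_sum (R * \<bar>t\<bar>) ^ m / fact m * exp (real q * t\<^sup>2)) UNIV"
      unfolding M_def by (simp only: prod.case) (rule has_sum_cmult_right)
  next
    have "(\<lambda>m. (R * \<bar>t\<bar>) ^ m / fact m) summable_on UNIV"
      using R0 summable_exp_terms by (subst summable_on_UNIV_nonneg_real_iff) auto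
    then show "(\<lambda>m. (R * \<bar>t\<bar>) ^ m / fact m * exp (real q * t\<^sup>2)) summable_on UNIV"
      by (rule summable_on_cmult_left)
  qed (use R0 in \<open>auto simp: M_def\<close>)
  moreover have "norm (f z) \<le> M z" if "z \<in> UNIV \<times> UNIV" for z
  proof (cases z)
    case (Pair m n)
    have even_power: "\<bar>t\<bar> ^ (2 * n + m) = (t\<^sup>2) ^ n * \<bar>t\<bar> ^ m"
      by (simp add: power_add power_mult)
    have "norm (f z) = \<bar>b m\<bar> * (real q ^ n * \<bar>t\<bar> ^ (2 * n + m)) / (fact n * fact (n + m))"
      by (simp add: f_def Pair abs_mult power_abs)
    also have "\<dots> \<le> R ^ m * (real q ^ n * \<bar>t\<bar> ^ (2 * n + m)) / (fact n * fact m)"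
      using R[of m] R0 by (intro frac_le mult_mono fact_mono) auto
    also have "\<dots> = M z"
      by (simp only: M_def Pair prod.case even_power power_mult_distrib) (simp add: mult_ac)
    finally show ?thesis .
  qed
  ultimately have "(\<lambda>z. norm (f z)) summable_on UNIV \<times> UNIV"
    by (rule Infinite_Sum.abs_summable_on_comparison_test')
  then have f_abs: "f summable_on UNIV \<times> UNIV"
    by (rule Infinite_Sum.abs_summable_summable)
  then obtain S where S: "(f has_sum S) (UNIV \<times> UNIV)"
    by (auto simp: summable_on_def)

  have row: "((\<lambda>n. f (m, n)) has_sum
      b m * real q powr (- real m / 2) * bessel_I m (2 * sqrt (real q) * t)) UNIV" for m
  proof -
    have fm: "f (m, n) = (b m * real q powr (- real m / 2)) *
        ((2 * sqrt (real q) * t / 2) ^ (2 * n + m) / (fact n * Gamma (real (n + 1 + m))))" for n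
    proof -
      have "Gamma (real (n + 1 + m)) = fact (n + m)"
        using Gamma_fact[of "n + m", where 'a = real] by (simp add: add_ac)
      moreover have "2 * sqrt (real q) * t / 2 = sqrt (real q) * t" by simp
      ultimately show ?thesis
        unfolding f_def prod.case scaled_bessel_term[OF q, of m t n, symmetric]
        by (simp only: mult.assoc times_divide_eq_right)
    qed
    have "(\<lambda>n. f (m, n)) summable_on UNIV"
      using f_abs summable_on_SigmaD1[of "\<lambda>m n. f (m, n)" UNIV "\<lambda>_. UNIV" m] by simp
    then have hs: "((\<lambda>n. f (m, n)) has_sum (\<Sum>n. f (m, n))) UNIV"
      by (metis has_sum_imp_sums has_sum_infsum sums_unique)
    \<comment> \<open>\<open>b m\<close> can only be cancelled from the summable row when it is nonzero.\<close>
    show ?thesis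
    proof (cases "b m = 0")
      case True
      then show ?thesis by (simp add: f_def)
    next
      case False
      have "summable (\<lambda>n. f (m, n))" using hs has_sum_imp_sums sums_summable by blast
      then have "summable (\<lambda>n. (2 * sqrt (real q) * t / 2) ^ (2 * n + m) / (fact n * Gamma (real (n + 1 + m))))"
        unfolding fm using False q by (subst (asm) summable_cmult_iff) auto
      then have "(\<Sum>n. f (m, n)) = b m * real q powr (- real m / 2) * bessel_I m (2 * sqrt (real q) * t)"
        unfolding fm bessel_I_def by (rule suminf_mult)
      with hs show ?thesis by simp
    qed
  qed
  have rows: "((\<lambda>m. b m * real q powr (- real m / 2) * bessel_I m (2 * sqrt (real q) * t)) has_sum S) UNIV"
    using has_sum_SigmaD[OF S row] .

  have "((\<lambda>(N, n). f (N - 2 * n, n)) has_sum S) (Sigma UNIV (\<lambda>N. {n. 2 * n \<le> N}))"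
  proof (subst has_sum_reindex_bij_witness[of _ "\<lambda>(m, n). (2 * n + m, n)" "\<lambda>(N, n). (N - 2 * n, n)"])
    show "(f has_sum S) (UNIV \<times> UNIV)" by (rule S)
  qed auto
  moreover have "((\<lambda>n. case (N, n) of (N, n) \<Rightarrow> f (N - 2 * n, n)) has_sum w N / fact N * t ^ N) {n. 2 * n \<le> N}" for N
  proof -
    have fin: "finite {n. 2 * n \<le> N}"
      by (rule finite_subset[of _ "{..N}"]) auto
    have "f (N - 2 * n, n) = real (N choose n) * real q ^ n * b (N - 2 * n) / fact N * t ^ N"
      if n: "2 * n \<le> N" for n
    proof -
      have "real (N choose n) / fact N = 1 / (fact n * fact (N - n))"
        using n binomial_fact[of n N, where 'a = real] by simp
      moreover have "2 * n + (N - 2 * n) = N" "n + (N - 2 * n) = N - n" using n by auto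
      moreover have "real (N choose n) * real q ^ n * b (N - 2 * n) / fact N * t ^ N
          = real (N choose n) / fact N * (real q ^ n * b (N - 2 * n) * t ^ N)" by simp
      ultimately show ?thesis by (simp add: f_def)
    qed
    then have "(\<Sum>n\<in>{n. 2 * n \<le> N}. f (N - 2 * n, n)) = w N / fact N * t ^ N"
      by (simp add: w_def sum_divide_distrib sum_distrib_right)
    with has_sum_finite[OF fin, of "\<lambda>n. f (N - 2 * n, n)"] show ?thesis by simp
  qed
  ultimately have "((\<lambda>N. w N / fact N * t ^ N) has_sum S) UNIV"
    by (rule has_sum_SigmaD)
  then have "(\<Sum>N. w N / fact N * t ^ N) = S"
    using has_sum_imp_sums sums_unique by metis
  with has_sum_imp_sums[OF rows] show ?thesis
    by (simp add: w_def)
qed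

section \<open>Geodesics and the adjacency operator\<close>

locale regular_bidirected_digraph = bidirected_digraph X arev
  for X :: "('v, 'e) pre_digraph" and arev :: "'e \<Rightarrow> 'e" +
  fixes q :: nat and x0 :: 'v
  assumes q_pos: "q > 0"
    and regular: "regular_graph X (q + 1)"
    and x0_vert: "x0 \<in> verts X"
begin

definition adj :: "('v \<Rightarrow> real) \<Rightarrow> 'v \<Rightarrow> real" where
  "adj f x = (\<Sum>e \<in> out_arcs X x. f (head X e))"

abbreviation geod_count :: "nat \<Rightarrow> 'v \<Rightarrow> real" where
  "geod_count m x \<equiv> real (geodesic_count X arev x0 m x)"

abbreviation geod_coeff :: "nat \<Rightarrow> 'v \<Rightarrow> real" where
  "geod_coeff m x \<equiv> geodesic_coeff q X arev x0 m x"

definition geodesics :: "nat \<Rightarrow> 'v \<Rightarrow> 'e list set" where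
  "geodesics m x = {p. geodesic X arev x0 p x \<and> length p = m}"

lemma card_out_arcs: "x \<in> verts X \<Longrightarrow> card (out_arcs X x) = q + 1"
  using regular by (simp add: regular_graph_def out_degree_def)

lemma finite_out_arcs: "x \<in> verts X \<Longrightarrow> finite (out_arcs X x)"
  using card_out_arcs[of x] card_ge_0_finite by force

lemma adj_cong: "(\<And>y. y \<in> verts X \<Longrightarrow> f y = g y) \<Longrightarrow> adj f x = adj g x"
  by (simp add: adj_def out_arcs_in_arcs)

lemma adj_bound:
  assumes "\<And>y. y \<in> verts X \<Longrightarrow> \<bar>f y\<bar> \<le> M" "x \<in> verts X"
  shows "\<bar>adj f x\<bar> \<le> (real q + 1) * M"
proof -
  have "\<bar>adj f x\<bar> \<le> (\<Sum>e \<in> out_arcs X x. \<bar>f (head X e)\<bar>)"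
    unfolding adj_def by (rule sum_abs)
  also have "\<dots> \<le> real (card (out_arcs X x)) * M"
    using assms(1) by (intro sum_bounded_above) (simp add: out_arcs_in_arcs)
  finally show ?thesis
    using card_out_arcs[OF assms(2)] by (simp add: add.commute)
qed

lemma geodesics_0: "geodesics 0 x = (if x = x0 then {[]} else {})"
  using x0_vert by (auto simp: geodesics_def geodesic_def awalk_def backtracks_def)

lemma backtracks_snoc:
  "backtracks arev (p @ [a]) \<longleftrightarrow> backtracks arev p \<or> (p \<noteq> [] \<and> a = arev (last p))"
proof
  assume "backtracks arev (p @ [a])"
  then obtain i where i: "Suc i < length (p @ [a])" "(p @ [a]) ! Suc i = arev ((p @ [a]) ! i)"
    unfolding backtracks_def by blast
  show "backtracks arev p \<or> (p \<noteq> [] \<and> a = arev (last p))"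
  proof (cases "Suc i < length p")
    case True
    then show ?thesis using i unfolding backtracks_def by (auto simp: nth_append)
  next
    case False
    then have *: "length p = Suc i" using i(1) by simp
    then have "p \<noteq> []" by auto
    with * i(2) show ?thesis by (auto simp: nth_append last_conv_nth)
  qed
next
  assume "backtracks arev p \<or> (p \<noteq> [] \<and> a = arev (last p))"
  then show "backtracks arev (p @ [a])"
  proof
    assume "backtracks arev p"
    then obtain i where "Suc i < length p" "p ! Suc i = arev (p ! i)"
      unfolding backtracks_def by blast
    then show ?thesis unfolding backtracks_def by (intro exI[of _ i]) (simp add: nth_append)
  next
    assume *: "p \<noteq> [] \<and> a = arev (last p)"
    then show ?thesis unfolding backtracks_def
      by (intro exI[of _ "length p - 1"]) (auto simp: nth_append last_conv_nth)
  qed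
qed

text \<open>
  Geodesics are taken apart at their terminal edge because the adjacency operator moves the
  endpoint \<open>x\<close>, while the starting vertex \<open>x0\<close> stays fixed.
\<close>
lemma snoc_in_geodesics:
  "p @ [a] \<in> geodesics (Suc m) x \<longleftrightarrow>
     a \<in> arcs X \<and> head X a = x \<and> p \<in> geodesics m (tail X a) \<and> (p = [] \<or> a \<noteq> arev (last p))"
  by (auto simp: geodesics_def geodesic_def awalk_append_iff awalk_Cons_iff awalk_Nil_iff
      backtracks_snoc)

lemma last_of_geodesic:
  assumes "p \<in> geodesics (Suc m) x"
  obtains p' a where "p = p' @ [a]" "a \<in> arcs X" "head X a = x"
proof -
  from assms have "p \<noteq> []" by (auto simp: geodesics_def)
  then obtain p' a where "p = p' @ [a]" by (metis rev_exhaust)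
  with assms snoc_in_geodesics that show ?thesis by blast
qed

lemma finite_geodesics: "x \<in> verts X \<Longrightarrow> finite (geodesics m x)"
proof (induction m arbitrary: x)
  case 0
  then show ?case by (simp add: geodesics_0)
next
  case (Suc m)
  have "geodesics (Suc m) x \<subseteq>
      (\<lambda>(e, p). p @ [arev e]) ` Sigma (out_arcs X x) (\<lambda>e. geodesics m (head X e))"
  proof
    fix p assume p: "p \<in> geodesics (Suc m) x"
    then obtain p' a where pa: "p = p' @ [a]" by (rule last_of_geodesic)
    with p show "p \<in> (\<lambda>(e, p). p @ [arev e]) ` Sigma (out_arcs X x) (\<lambda>e. geodesics m (head X e))"
      by (intro image_eqI[of _ _ "(arev a, p')"]) (auto simp: snoc_in_geodesics)
  qed
  moreover have "finite (Sigma (out_arcs X x) (\<lambda>e. geodesics m (head X e)))"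
    using Suc by (intro finite_SigmaI finite_out_arcs) (auto simp: out_arcs_in_arcs)
  ultimately show ?case using finite_surj by blast
qed

text \<open>
  The pairs \<open>(e, p)\<close> counted here represent the walks \<open>p\<close> followed by the reversal of \<open>e\<close>: one
  step from the end of a geodesic to \<open>x\<close>, possibly cancelling its last edge. The next two lemmas
  count the pairs without and with cancellation.
\<close>
lemma adj_geod_count_eq_card:
  assumes "x \<in> verts X"
  shows "adj (geod_count m) x = real (card (Sigma (out_arcs X x) (\<lambda>e. geodesics m (head X e))))"
  using assms finite_geodesics
  by (subst card_SigmaI)
    (auto simp: adj_def geodesic_count_def geodesics_def finite_out_arcs)

lemma extensions_card:
  "card {(e, p). e \<in> out_arcs X x \<and> p \<in> geodesics m (head X e) \<and> (p = [] \<or> last p \<noteq> e)}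
    = card (geodesics (Suc m) x)"
proof (rule bij_betw_same_card[of "\<lambda>(e, p). p @ [arev e]"], rule bij_betw_imageI)
  let ?S = "{(e, p). e \<in> out_arcs X x \<and> p \<in> geodesics m (head X e) \<and> (p = [] \<or> last p \<noteq> e)}"
  show "inj_on (\<lambda>(e, p). p @ [arev e]) ?S"
    by (auto simp: inj_on_def arev_eq_iff)
  show "(\<lambda>(e, p). p @ [arev e]) ` ?S = geodesics (Suc m) x"
  proof (intro equalityI subsetI)
    fix p assume "p \<in> (\<lambda>(e, p). p @ [arev e]) ` ?S"
    then show "p \<in> geodesics (Suc m) x"
      using snoc_in_geodesics[of "[]"] by (auto simp: snoc_in_geodesics arev_eq_iff)
  next
    fix p assume p: "p \<in> geodesics (Suc m) x"
    then obtain p' a where pa: "p = p' @ [a]" by (rule last_of_geodesic)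
    with p show "p \<in> (\<lambda>(e, p). p @ [arev e]) ` ?S"
      by (intro image_eqI[of _ _ "(arev a, p')"]) (auto simp: snoc_in_geodesics)
  qed
qed

text \<open>
  If the added edge is the reversal of the last one, removing both leaves a geodesic \<open>p\<close> of length
  \<open>m\<close> ending at \<open>x\<close>, and \<open>e\<close> is any edge leaving \<open>x\<close> other than the reversal of the last edge
  of \<open>p\<close>. Only the empty \<open>p\<close> has no last edge and excludes nothing, hence the exceptional
  factor.
\<close>
lemma cancellations_card:
  assumes x: "x \<in> verts X"
  shows "card {(e, p). e \<in> out_arcs X x \<and> p \<in> geodesics (Suc m) (head X e) \<and> last p = e}
    = (if m = 0 then q + 1 else q) * card (geodesics m x)"
proof -
  let ?T = "\<lambda>p. {e \<in> out_arcs X x. p = [] \<or> e \<noteq> arev (last p)}"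
  have "card {(e, p). e \<in> out_arcs X x \<and> p \<in> geodesics (Suc m) (head X e) \<and> last p = e}
      = card (Sigma (geodesics m x) ?T)"
  proof (rule sym, rule bij_betw_same_card[of "\<lambda>(p, e). (e, p @ [e])"], rule bij_betw_imageI)
    show "inj_on (\<lambda>(p, e). (e, p @ [e])) (Sigma (geodesics m x) ?T)"
      by (auto simp: inj_on_def)
    show "(\<lambda>(p, e). (e, p @ [e])) ` Sigma (geodesics m x) ?T
      = {(e, p). e \<in> out_arcs X x \<and> p \<in> geodesics (Suc m) (head X e) \<and> last p = e}"
    proof (intro equalityI subsetI)
      fix z assume "z \<in> (\<lambda>(p, e). (e, p @ [e])) ` Sigma (geodesics m x) ?T"
      then show "z \<in> {(e, p). e \<in> out_arcs X x \<and> p \<in> geodesics (Suc m) (head X e) \<and> last p = e}"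
        using snoc_in_geodesics[of "[]"] by (auto simp: snoc_in_geodesics)
    next
      fix z assume "z \<in> {(e, p). e \<in> out_arcs X x \<and> p \<in> geodesics (Suc m) (head X e) \<and> last p = e}"
      then obtain e p where z: "z = (e, p)" "e \<in> out_arcs X x" "p \<in> geodesics (Suc m) (head X e)"
        "last p = e" by blast
      from z(3) obtain p' a where pa: "p = p' @ [a]" by (rule last_of_geodesic)
      with z show "z \<in> (\<lambda>(p, e). (e, p @ [e])) ` Sigma (geodesics m x) ?T"
        by (intro image_eqI[of _ _ "(p', e)"]) (auto simp: snoc_in_geodesics)
    qed
  qed
  also have "\<dots> = (\<Sum>p \<in> geodesics m x. card (?T p))"
    using finite_geodesics[OF x] finite_out_arcs[OF x] 
    by (intro card_SigmaI ballI) (auto intro: rev_finite_subset)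
  also have "\<dots> = (\<Sum>p \<in> geodesics m x. if m = 0 then q + 1 else q)"
  proof (rule sum.cong[OF refl])
    fix p assume p: "p \<in> geodesics m x"
    show "card (?T p) = (if m = 0 then q + 1 else q)"
    proof (cases m)
      case 0
      with p have "?T p = out_arcs X x" by (auto simp: geodesics_def)
      with 0 show ?thesis using card_out_arcs[OF x] by simp
    next
      case (Suc k)
      with p obtain p' a where pa: "p = p' @ [a]" "a \<in> arcs X" "head X a = x"
        using last_of_geodesic by metis
      then have "?T p = out_arcs X x - {arev a}" "arev a \<in> out_arcs X x" by auto
      with Suc show ?thesis using card_out_arcs[OF x] finite_out_arcs[OF x] by simp
    qed
  qed
  finally show ?thesis by simp
qed

lemma adj_geod_count_Suc:
  assumes x: "x \<in> verts X"
  shows "adj (geod_count (Suc m)) x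
    = geod_count (Suc (Suc m)) x + (if m = 0 then real q + 1 else real q) * geod_count m x"
proof -
  let ?P = "Sigma (out_arcs X x) (\<lambda>e. geodesics (Suc m) (head X e))"
  let ?E = "{(e, p). e \<in> out_arcs X x \<and> p \<in> geodesics (Suc m) (head X e) \<and> (p = [] \<or> last p \<noteq> e)}"
  let ?C = "{(e, p). e \<in> out_arcs X x \<and> p \<in> geodesics (Suc m) (head X e) \<and> last p = e}"
  have "finite ?P"
    using x finite_geodesics finite_out_arcs by (intro finite_SigmaI) (auto simp: out_arcs_in_arcs)
  moreover have P: "?P = ?E \<union> ?C" by auto
  ultimately have fin: "finite ?E" "finite ?C"
    by (simp_all only: finite_Un)
  have "?E \<inter> ?C = {}" by (auto simp: geodesics_def)
  then have "card ?P = card ?E + card ?C"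
    using card_Un_disjoint[OF fin] P by simp
  then show ?thesis
    unfolding adj_geod_count_eq_card[OF x] extensions_card cancellations_card[OF x]
    by (auto simp: geodesic_count_def geodesics_def)
qed

lemma adj_geod_count_0:
  assumes x: "x \<in> verts X"
  shows "adj (geod_count 0) x = geod_count (Suc 0) x"
proof -
  have "Sigma (out_arcs X x) (\<lambda>e. geodesics 0 (head X e))
    = {(e, p). e \<in> out_arcs X x \<and> p \<in> geodesics 0 (head X e) \<and> (p = [] \<or> last p \<noteq> e)}"
    by (auto simp: geodesics_def)
  then show ?thesis
    unfolding adj_geod_count_eq_card[OF x] using extensions_card[where m = 0]
    by (simp add: geodesic_count_def geodesics_def)
qed

lemma geod_coeff_0: "geod_coeff 0 x = (if x = x0 then 1 else 0)"
  using geodesics_0[of x] by (simp add: geodesic_coeff_def geodesic_count_def geodesics_def)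

lemma geod_coeff_1: "geod_coeff (Suc 0) x = geod_count (Suc 0) x"
  by (simp add: geodesic_coeff_def)

lemma geod_coeff_Suc_Suc:
  "geod_coeff (m + 2) x = geod_count (m + 2) x - real q * geod_count m x + geod_coeff m x"
proof -
  have "(\<Sum>j = 1..(m + 2) div 2. geod_count (m + 2 - 2 * j) x)
    = (\<Sum>j = 0..m div 2. geod_count (m - 2 * j) x)"
    using sum.shift_bounds_cl_Suc_ivl[of "\<lambda>j. geod_count (m + 2 - 2 * j) x" 0 "m div 2"]
    by simp
  also have "\<dots> = geod_count m x + (\<Sum>j = 1..m div 2. geod_count (m - 2 * j) x)"
    by (subst sum.atLeast_Suc_atMost) simp_all
  finally have tail_sum: "(\<Sum>j = 1..(m + 2) div 2. geod_count (m + 2 - 2 * j) x)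
    = geod_count m x + (\<Sum>j = 1..m div 2. geod_count (m - 2 * j) x)" .
  show ?thesis
    unfolding geodesic_coeff_def tail_sum by (simp only: algebra_simps)
qed

lemma adj_linear:
  "adj (\<lambda>x. f x + g x) x = adj f x + adj g x"
  "adj (\<lambda>x. f x - g x) x = adj f x - adj g x"
  "adj (\<lambda>x. c * f x) x = c * adj f x"
  "adj (\<lambda>x. \<Sum>i\<in>I. h i x) x = (\<Sum>i\<in>I. adj (h i) x)"
  unfolding adj_def by (rule sum.distrib sum_subtractf sum_distrib_left[symmetric] sum.swap)+

lemma adj_geod_coeff_0: "x \<in> verts X \<Longrightarrow> adj (geod_coeff 0) x = geod_coeff 1 x"
  using adj_geod_count_0[of x] by (simp add: geodesic_coeff_def)

lemma adj_geod_coeff_1: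
  assumes "x \<in> verts X"
  shows "adj (geod_coeff 1) x = geod_coeff 2 x + 2 * real q * geod_coeff 0 x"
proof -
  have "adj (geod_coeff 1) x = geod_count 2 x + (real q + 1) * geod_count 0 x"
    using adj_geod_count_Suc[OF assms, of 0] by (simp add: geodesic_coeff_def numeral_2_eq_2)
  then show ?thesis
    using geod_coeff_Suc_Suc[of 0 x] by (simp add: geodesic_coeff_def algebra_simps numeral_2_eq_2)
qed

text \<open>
  Subtracting the defining sums for \<open>m + 2\<close> and \<open>m\<close> leaves a combination of two geodesic counts
  (\<open>geod_coeff_Suc_Suc\<close>), which lets the recurrence of the counts pass to the coefficients by
  induction in steps of two. The exceptional factor in the recurrence of the counts enters only
  through the case \<open>m = 1\<close>.
\<close>
lemma adj_geod_coeff_Suc_Suc: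
  assumes x: "x \<in> verts X"
  shows "adj (geod_coeff (m + 2)) x = geod_coeff (m + 3) x + real q * geod_coeff (m + 1) x"
proof (induction m rule: less_induct)
  case (less m)
  have step: "adj (geod_coeff (m + 2)) x
      = adj (geod_count (m + 2)) x - real q * adj (geod_count m) x + adj (geod_coeff m) x"
    unfolding geod_coeff_Suc_Suc by (simp add: adj_linear)
  have top: "adj (geod_count (m + 2)) x = geod_count (m + 3) x + real q * geod_count (m + 1) x"
    using adj_geod_count_Suc[OF x, of "m + 1"] by (simp add: numeral_3_eq_3)
  have next_coeff: "geod_coeff (m + 3) x =
      geod_count (m + 3) x - real q * geod_count (m + 1) x + geod_coeff (m + 1) x"
    using geod_coeff_Suc_Suc[of "m + 1" x] by (simp add: numeral_3_eq_3)
  consider "m = 0" | "m = 1" | k where "m = k + 2"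
    by (metis One_nat_def add_2_eq_Suc' not0_implies_Suc)
  then show ?case
  proof cases
    case 1
    then show ?thesis
      using step top next_coeff adj_geod_count_0[OF x] adj_geod_coeff_0[OF x] geod_coeff_1[of x] by simp
  next
    case 2
    have two: "m + 1 = 2" using 2 by simp
    have a: "adj (geod_count m) x = geod_count 2 x + (real q + 1) * geod_count 0 x"
      using adj_geod_count_Suc[OF x, of 0] 2 by (simp add: numeral_2_eq_2)
    have b: "geod_coeff 2 x = geod_count 2 x - real q * geod_count 0 x + geod_count 0 x"
      using geod_coeff_Suc_Suc[of 0 x] by (simp add: numeral_2_eq_2 geodesic_coeff_def)
    have c: "adj (geod_coeff m) x = geod_coeff 2 x + 2 * real q * geod_count 0 x"
      using adj_geod_coeff_1[OF x] 2 by (simp add: geodesic_coeff_def[of _ _ _ _ 0])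
    show ?thesis
      unfolding step top next_coeff two a c b by (simp add: algebra_simps)
  next
    case 3
    have a: "adj (geod_count m) x = geod_count (m + 1) x + real q * geod_count (k + 1) x"
      using adj_geod_count_Suc[OF x, of "k + 1"] 3 by (simp add: numeral_3_eq_3)
    have b: "geod_coeff (m + 1) x =
        geod_count (m + 1) x - real q * geod_count (k + 1) x + geod_coeff (k + 1) x"
      using geod_coeff_Suc_Suc[of "k + 1" x] 3 by simp
    have c: "adj (geod_coeff m) x = geod_coeff (m + 1) x + real q * geod_coeff (k + 1) x"
      using less.IH[of k] 3 by (simp add: numeral_3_eq_3)
    show ?thesis
      unfolding step top next_coeff a c b by (simp add: algebra_simps)
  qed
qed

section \<open>Powers of the adjacency operator\<close>

text \<open>
  Solving the recurrence for its leading term and using that \<open>A\<close> has norm at most \<open>q + 1\<close> gives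
  growth by at most \<open>(q + 1) + 2 q\<close> per step; the \<open>2 q\<close> comes from the exceptional relation for
  \<open>A b\<^sub>1\<close>.
\<close>
lemma geod_coeff_bound: "x \<in> verts X \<Longrightarrow> \<bar>geod_coeff m x\<bar> \<le> (3 * real q + 1) ^ m"
proof (induction m arbitrary: x rule: less_induct)
  case (less m)
  let ?R = "3 * real q + 1"
  show ?case
  proof (cases m)
    case 0
    then show ?thesis by (simp add: geod_coeff_0)
  next
    case (Suc k)
    have "\<bar>geod_coeff y z\<bar> \<le> ?R ^ y" if "y \<le> k" "z \<in> verts X" for y z
      using less.IH[of y z] that Suc by simp
    note IH = this
    have A: "\<bar>adj (geod_coeff k) x\<bar> \<le> (real q + 1) * ?R ^ k"
      using IH less.prems by (intro adj_bound) auto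
    show ?thesis
    proof (cases k)
      case 0
      then show ?thesis
        using A adj_geod_coeff_0[OF less.prems] Suc by simp
    next
      case (Suc l)
      have "geod_coeff (k + 1) x = adj (geod_coeff k) x - (if l = 0 then 2 * real q else real q) * geod_coeff l x"
      proof (cases l)
        case 0
        then show ?thesis using adj_geod_coeff_1[OF less.prems] Suc by (simp add: numeral_2_eq_2)
      next
        case (Suc j)
        then show ?thesis
          using adj_geod_coeff_Suc_Suc[OF less.prems, of j] \<open>k = Suc l\<close> by (simp add: numeral_3_eq_3)
      qed
      then have "\<bar>geod_coeff (k + 1) x\<bar> \<le> \<bar>adj (geod_coeff k) x\<bar>
          + \<bar>(if l = 0 then 2 * real q else real q) * geod_coeff l x\<bar>"
        by (simp only: abs_triangle_ineq4)
      also have "\<bar>(if l = 0 then 2 * real q else real q) * geod_coeff l x\<bar> \<le> 2 * real q * ?R ^ k"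
      proof -
        have "\<bar>geod_coeff l x\<bar> \<le> ?R ^ k"
          using IH[of l x] less.prems Suc power_increasing[of l k ?R] by linarith
        then show ?thesis by (auto simp: abs_mult intro!: mult_mono)
      qed
      finally show ?thesis using A \<open>m = Suc k\<close> by (simp add: algebra_simps)
    qed
  qed
qed

text \<open>
  The two-sided extension of the coefficients that removes the boundary terms at \<open>m = 0\<close> and
  \<open>m = 1\<close> from their recurrence. Its value at \<open>0\<close> is doubled because the relation for \<open>A b\<^sub>1\<close>
  contains \<open>2 q b\<^sub>0\<close>.
\<close>
definition reflected_geod_coeff :: "int \<Rightarrow> 'v \<Rightarrow> real" where
  "reflected_geod_coeff k x =
     (if k > 0 then geod_coeff (nat k) x
      else if k = 0 then 2 * geod_coeff 0 x
      else geod_coeff (nat (- k)) x / real q ^ nat (- k))"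

lemma adj_reflected_geod_coeff:
  assumes x: "x \<in> verts X"
  shows "adj (reflected_geod_coeff k) x = reflected_geod_coeff (k + 1) x + real q * reflected_geod_coeff (k - 1) x"
proof -
  have adj_scaled: "adj (\<lambda>y. f y / c) x = adj f x / c" for f c
    by (simp add: adj_def sum_divide_distrib)
  have unfold: "reflected_geod_coeff k = (\<lambda>x. if k > 0 then geod_coeff (nat k) x
      else if k = 0 then 2 * geod_coeff 0 x
      else geod_coeff (nat (- k)) x / real q ^ nat (- k))" for k
    by (simp add: reflected_geod_coeff_def fun_eq_iff)
  consider "k = 0" | "k = 1" | "k = - 1" | j where "k = int (j + 2)" | j where "k = - int (j + 2)"
  proof -
    have "k = int (nat (k - 2) + 2)" if "k > 1" using that by simp
    moreover have "k = - int (nat (- k - 2) + 2)" if "k < - 1" using that by simp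
    moreover have "k > 1 \<or> k < - 1 \<or> k = 0 \<or> k = 1 \<or> k = - 1" by linarith
    ultimately show ?thesis using that by blast
  qed
  then show ?thesis
  proof cases
    case 1
    then show ?thesis
      using adj_geod_coeff_0[OF x] q_pos by (simp add: unfold adj_linear)
  next
    case 2
    then show ?thesis
      using adj_geod_coeff_1[OF x] by (simp add: unfold)
  next
    case 3
    then show ?thesis
      using adj_geod_coeff_1[OF x] q_pos by (simp add: unfold adj_scaled field_simps power2_eq_square)
  next
    case 4
    have n: "nat k = j + 2" "nat (k + 1) = j + 3" "nat (k - 1) = j + 1" "k > 0" "k - 1 > 0" "k + 1 > 0"
      using 4 by auto
    show ?thesis
      using adj_geod_coeff_Suc_Suc[OF x, of j] n by (simp only: unfold if_True)
  next
    case 5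
    have n: "nat (- k) = j + 2" "nat (- (k + 1)) = j + 1" "nat (- (k - 1)) = j + 3"
      "\<not> k > 0" "\<not> k - 1 > 0" "\<not> k + 1 > 0" "k \<noteq> 0" "k + 1 \<noteq> 0" "k - 1 \<noteq> 0"
      using 5 by auto
    show ?thesis
      unfolding unfold adj_scaled n if_False using n(4-9) adj_geod_coeff_Suc_Suc[OF x, of j] q_pos
      by (simp add: adj_scaled field_simps power_add power2_eq_square power3_eq_cube)
  qed
qed

text \<open>
  \<open>A\<^sup>N\<close> applied to the point mass at \<open>x0\<close>, that is, the number of all walks of length \<open>N\<close> from
  \<open>x\<close> to \<open>x0\<close>, backtracking or not.
\<close>
definition walk_count :: "nat \<Rightarrow> 'v \<Rightarrow> real" where
  "walk_count N = (adj ^^ N) (\<lambda>x. if x = x0 then 1 else 0)"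

lemma walk_count_0: "walk_count 0 x = (if x = x0 then 1 else 0)"
  by (simp add: walk_count_def)

lemma walk_count_Suc: "walk_count (Suc N) = adj (walk_count N)"
  by (simp add: walk_count_def)

lemma walk_count_bound: "x \<in> verts X \<Longrightarrow> \<bar>walk_count N x\<bar> \<le> (real q + 1) ^ N"
proof (induction N arbitrary: x)
  case 0
  then show ?case by (simp add: walk_count_0)
next
  case (Suc N)
  then show ?case using adj_bound[of "walk_count N" "(real q + 1) ^ N" x]
    by (simp add: walk_count_Suc)
qed

text \<open>
  On the reflected coefficients \<open>A\<close> acts as the sum of the shift \<open>k \<mapsto> k + 1\<close> and \<open>q\<close> times the
  shift \<open>k \<mapsto> k - 1\<close>; these commute, and the binomial theorem gives \<open>A\<^sup>N\<close>. The induction step is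
  Pascal's rule.
\<close>
lemma walk_count_reflected:
  "x \<in> verts X \<Longrightarrow> 2 * walk_count N x
    = (\<Sum>n\<le>N. real (N choose n) * real q ^ n * reflected_geod_coeff (int N - 2 * int n) x)"
proof (induction N arbitrary: x)
  case 0
  then show ?case by (simp add: walk_count_0 geod_coeff_0 reflected_geod_coeff_def)
next
  case (Suc N)
  let ?r = "\<lambda>k. reflected_geod_coeff k x"
  let ?s = "int N + 1"
  have "2 * walk_count (Suc N) x = adj (\<lambda>y. 2 * walk_count N y) x"
    by (simp add: walk_count_Suc adj_linear)
  also have "\<dots> = adj (\<lambda>y. \<Sum>n\<le>N. real (N choose n) * real q ^ n
      * reflected_geod_coeff (int N - 2 * int n) y) x"
    by (rule adj_cong) (rule Suc.IH)
  also have "\<dots> = (\<Sum>n\<le>N. real (N choose n) * real q ^ n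
      * (?r (int N - 2 * int n + 1) + real q * ?r (int N - 2 * int n - 1)))"
    by (simp only: adj_linear adj_reflected_geod_coeff[OF Suc.prems])
  also have "\<dots> = (\<Sum>n\<le>N. real (N choose n) * real q ^ n * ?r (?s - 2 * int n))
      + (\<Sum>n\<le>N. real (N choose n) * real q ^ Suc n * ?r (?s - 2 * int (Suc n)))"
    by (simp add: sum.distrib[symmetric] algebra_simps)
  also have "(\<Sum>n\<le>N. real (N choose n) * real q ^ n * ?r (?s - 2 * int n))
      = (\<Sum>n\<le>Suc N. real (N choose n) * real q ^ n * ?r (?s - 2 * int n))"
    by simp
  also have "\<dots> = ?r ?s + (\<Sum>n\<le>N. real (N choose Suc n) * real q ^ Suc n * ?r (?s - 2 * int (Suc n)))"
    by (subst sum.atMost_Suc_shift) simp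
  also have "?r ?s + (\<Sum>n\<le>N. real (N choose Suc n) * real q ^ Suc n * ?r (?s - 2 * int (Suc n)))
      + (\<Sum>n\<le>N. real (N choose n) * real q ^ Suc n * ?r (?s - 2 * int (Suc n)))
      = ?r ?s + (\<Sum>n\<le>N. real (Suc N choose Suc n) * real q ^ Suc n * ?r (?s - 2 * int (Suc n)))"
    by (simp add: sum.distrib[symmetric] algebra_simps)
  also have "\<dots> = (\<Sum>n\<le>Suc N. real (Suc N choose n) * real q ^ n * ?r (int (Suc N) - 2 * int n))"
    by (subst sum.atMost_Suc_shift) (simp add: add.commute)
  finally show ?case .
qed

text \<open>
  The factor \<open>q\<^sup>-\<^sup>k\<close> in the reflected coefficients makes the terms for \<open>n\<close> and \<open>N - n\<close> in
  \<open>walk_count_reflected\<close> equal, so that the factor \<open>2\<close> there disappears when the sum is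
  folded.
\<close>
lemma walk_count_eq:
  assumes x: "x \<in> verts X"
  shows "walk_count N x
    = (\<Sum>n\<in>{n. 2 * n \<le> N}. real (N choose n) * real q ^ n * geod_coeff (N - 2 * n) x)"
proof -
  let ?g = "\<lambda>n. real (N choose n) * real q ^ n * reflected_geod_coeff (int N - 2 * int n) x"
  let ?h = "\<lambda>n. real (N choose n) * real q ^ n * geod_coeff (N - 2 * n) x"
  have "(\<Sum>n\<le>N. ?g n) = (\<Sum>n\<in>{n. 2 * n \<le> N}. ?h n) + (\<Sum>n\<in>{n. 2 * n \<le> N}. ?h n)"
  proof (rule fold_reflected_sum)
    fix n assume n: "2 * n < N"
    then have "nat (int N - 2 * int n) = N - 2 * n" "int N - 2 * int n > 0" by auto
    then show "?g n = ?h n" by (simp add: reflected_geod_coeff_def)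
  next
    fix n assume "2 * n = N"
    then show "?g n = ?h n + ?h n" by (auto simp: reflected_geod_coeff_def)
  next
    fix n assume n: "N < 2 * n" "n \<le> N"
    then have i: "nat (- (int N - 2 * int n)) = 2 * n - N" "int N - 2 * int n < 0" by auto
    have "n = (N - n) + (2 * n - N)" using n by simp
    then have "real q ^ n = real q ^ (N - n) * real q ^ (2 * n - N)"
      by (metis power_add)
    moreover have "N - 2 * (N - n) = 2 * n - N" using n by simp
    moreover have "N choose n = N choose (N - n)" using n by (intro binomial_symmetric)
    ultimately show "?g n = ?h (N - n)"
      using i q_pos by (simp add: reflected_geod_coeff_def)
  qed
  with walk_count_reflected[OF x, of N] show ?thesis by simp
qed

section \<open>Existence and uniqueness of the heat kernel\<close>

definition walk_series :: "real \<Rightarrow> 'v \<Rightarrow> real" where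
  "walk_series t x = (\<Sum>N. walk_count N x / fact N * t ^ N)"

lemma bessel_series_sums:
  assumes "x \<in> verts X"
  shows "(\<lambda>m. geod_coeff m x * real q powr (- real m / 2) * bessel_I m (2 * sqrt (real q) * t))
    sums walk_series t x"
  using rearrange_bessel_series[OF q_pos geod_coeff_bound[OF assms], of t]
  by (simp add: walk_series_def walk_count_eq[OF assms])

lemma walk_term_bound:
  assumes "x \<in> verts X"
  shows "\<bar>walk_count N x / fact N * t ^ N\<bar> \<le> ((real q + 1) * \<bar>t\<bar>) ^ N / fact N"
  using walk_count_bound[OF assms, of N]
  by (simp add: abs_mult power_abs power_mult_distrib divide_right_mono mult_right_mono)

lemma summable_walk_series:
  "x \<in> verts X \<Longrightarrow> summable (\<lambda>N. walk_count N x / fact N * t ^ N)"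
  by (rule summable_comparison_test'[OF summable_exp_terms[of "(real q + 1) * \<bar>t\<bar>"]])
    (simp only: real_norm_def walk_term_bound)

lemma walk_series_bound:
  assumes "x \<in> verts X"
  shows "\<bar>walk_series t x\<bar> \<le> exp ((real q + 1) * \<bar>t\<bar>)"
proof -
  let ?E = "\<lambda>N. ((real q + 1) * \<bar>t\<bar>) ^ N / fact N"
  have "norm (walk_series t x) \<le> (\<Sum>N. ?E N)"
    unfolding walk_series_def
    by (rule norm_suminf_le[OF _ summable_exp_terms]) (simp only: real_norm_def walk_term_bound[OF assms])
  also have "\<dots> = exp ((real q + 1) * \<bar>t\<bar>)"
    by (simp add: exp_def divide_inverse_commute)
  finally show ?thesis by simp
qed

text \<open>
  Differentiating an exponential generating function shifts its coefficients, and the shifted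
  coefficients are \<open>A\<close> applied to the original ones.
\<close>
lemma walk_series_deriv:
  assumes x: "x \<in> verts X"
  shows "((\<lambda>t. walk_series t x) has_real_derivative adj (walk_series t) x) (at t)"
proof -
  have "adj (walk_series t) x = (\<Sum>N. \<Sum>e\<in>out_arcs X x. walk_count N (head X e) / fact N * t ^ N)"
    unfolding adj_def walk_series_def
    by (rule suminf_sum[symmetric]) (rule summable_walk_series, simp add: out_arcs_in_arcs)
  also have "\<dots> = (\<Sum>N. diffs (\<lambda>N. walk_count N x / fact N) N * t ^ N)"
    by (rule suminf_cong)
      (simp add: diffs_def walk_count_Suc adj_def sum_distrib_right sum_divide_distrib[symmetric]
        del: of_nat_Suc)
  finally have "adj (walk_series t) x = (\<Sum>N. diffs (\<lambda>N. walk_count N x / fact N) N * t ^ N)" .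
  then show ?thesis
    unfolding walk_series_def[of _ x]
    using termdiffs_strong_converges_everywhere[OF summable_walk_series[OF x]] by simp
qed

lemma laplacian_eq_adj: "laplacian q X f x = (real q + 1) * f x - adj f x"
  by (simp add: laplacian_def adj_def)

text \<open>
  The exponential factor accounts for the diagonal part \<open>q + 1\<close> of the Laplacian. It also exactly
  compensates the growth \<open>e\<^sup>(\<^sup>q\<^sup>+\<^sup>1\<^sup>)\<^sup>t\<close> of the series, so the product is bounded by \<open>1\<close>.
\<close>
lemma heat_kernel_walk_series:
  "is_heat_kernel q X x0 (\<lambda>t x. exp (- (real q + 1) * t) * walk_series t x)"
proof -
  let ?K = "\<lambda>t x. exp (- (real q + 1) * t) * walk_series t x"
  have "\<exists>D. ((\<lambda>s. ?K s x) has_real_derivative D) (at t within {0..}) \<and> laplacian q X (?K t) x + D = 0"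
    if x: "x \<in> verts X" for t x
  proof (intro exI conjI)
    show "((\<lambda>s. ?K s x) has_real_derivative
        exp (- (real q + 1) * t) * adj (walk_series t) x - (real q + 1) * ?K t x) (at t within {0..})"
      by (rule has_field_derivative_at_within)
        (auto intro!: derivative_eq_intros walk_series_deriv[OF x] simp: algebra_simps)
    show "laplacian q X (?K t) x
        + (exp (- (real q + 1) * t) * adj (walk_series t) x - (real q + 1) * ?K t x) = 0"
      by (simp add: laplacian_eq_adj adj_linear)
  qed
  moreover have "?K 0 x = (if x = x0 then 1 else 0)" for x
  proof -
    have "walk_series 0 x = walk_count 0 x"
      using powser_zero[of "\<lambda>N. walk_count N x / fact N"] by (simp add: walk_series_def)
    then show ?thesis by (simp add: walk_count_0)
  qed
  moreover have "\<bar>?K t x\<bar> \<le> 1" if "t \<ge> 0" "x \<in> verts X" for t x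
  proof -
    have "\<bar>?K t x\<bar> = exp (- (real q + 1) * t) * \<bar>walk_series t x\<bar>"
      by (simp add: abs_mult)
    also have "\<dots> \<le> exp (- (real q + 1) * t) * exp ((real q + 1) * \<bar>t\<bar>)"
      using walk_series_bound[OF that(2)] by (intro mult_left_mono) auto
    also have "\<dots> = 1" using that(1) by (simp add: exp_add[symmetric] algebra_simps)
    finally show ?thesis .
  qed
  ultimately show ?thesis unfolding is_heat_kernel_def by blast
qed

text \<open>
  The Laplacian has norm at most \<open>C = 2 (q + 1)\<close> on bounded functions. Hence a bound
  \<open>B (C t)\<^sup>n / n!\<close> for \<open>L\<close> bounds the time derivative by \<open>C\<close> times this, and integration from
  \<open>L 0 = 0\<close> improves it to \<open>B (C t)\<^sup>n\<^sup>+\<^sup>1 / (n + 1)!\<close>. As \<open>n\<close> grows these bounds tend to \<open>0\<close> for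
  every fixed \<open>t\<close>.
\<close>
lemma bounded_heat_solution_zero:
  assumes deriv: "\<And>t x. t \<ge> 0 \<Longrightarrow> x \<in> verts X \<Longrightarrow>
      ((\<lambda>s. L s x) has_real_derivative - laplacian q X (L t) x) (at t within {0..})"
    and init: "\<And>x. x \<in> verts X \<Longrightarrow> L 0 x = 0"
    and bounded: "\<And>t x. t \<ge> 0 \<Longrightarrow> x \<in> verts X \<Longrightarrow> \<bar>L t x\<bar> \<le> B"
    and t: "t \<ge> 0" and x: "x \<in> verts X"
  shows "L t x = 0"
proof -
  let ?C = "2 * (real q + 1)"
  have iterate: "\<bar>L t x\<bar> \<le> B * ((?C * t) ^ n / fact n)" if "t \<ge> 0" "x \<in> verts X" for n t x
    using that
  proof (induction n arbitrary: t x)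
    case 0
    then show ?case using bounded by simp
  next
    case (Suc n)
    let ?\<phi> = "\<lambda>s. B * ((?C * s) ^ Suc n / fact (Suc n))"
    let ?d = "\<lambda>s. B * (?C * ((?C * s) ^ n / fact n))"
    have lap: "\<bar>laplacian q X (L s) x\<bar> \<le> ?d s" if s: "s \<ge> 0" for s
    proof -
      let ?b = "B * ((?C * s) ^ n / fact n)"
      have "\<bar>laplacian q X (L s) x\<bar> \<le> \<bar>(real q + 1) * L s x\<bar> + \<bar>adj (L s) x\<bar>"
        unfolding laplacian_eq_adj by (rule abs_triangle_ineq4)
      also have "\<dots> \<le> (real q + 1) * ?b + (real q + 1) * ?b"
      proof (intro add_mono adj_bound)
        show "\<bar>(real q + 1) * L s x\<bar> \<le> (real q + 1) * ?b"
          unfolding abs_mult using Suc.IH[OF s Suc.prems(2)] by (intro mult_mono) auto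
      qed (use Suc.IH[OF s] Suc.prems in auto)
      also have "\<dots> = ?d s" by (simp add: algebra_simps)
      finally show ?thesis .
    qed
    have d\<phi>: "(?\<phi> has_real_derivative ?d s) (at s)" for s
    proof -
      have "(?\<phi> has_real_derivative B * (real (Suc n) * (?C * s) ^ n * ?C / fact (Suc n))) (at s)"
        by (auto intro!: derivative_eq_intros simp del: power_Suc fact_Suc of_nat_Suc)
      moreover have "real (Suc n) * (?C * s) ^ n * ?C / fact (Suc n) = ?C * ((?C * s) ^ n / fact n)"
        by (simp add: fact_Suc del: of_nat_Suc)
      ultimately show ?thesis by (simp only:)
    qed
    show ?case
    proof (cases "t = 0")
      case True
      then show ?thesis using init Suc.prems by simp
    next
      case False
      have "norm (L t x - L 0 x) \<le> ?\<phi> t - ?\<phi> 0"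
      proof (rule differentiable_bound_general[where f' = "\<lambda>s. - laplacian q X (L s) x" and \<phi>' = ?d])
        show "0 < t" using False Suc.prems by simp
        show "continuous_on {0..t} (\<lambda>s. L s x)"
          by (rule continuous_on_subset[of "{0..}"], rule DERIV_continuous_on, rule deriv)
            (use Suc.prems in auto)
        show "continuous_on {0..t} ?\<phi>"
          by (intro continuous_intros) auto
        (* At a positive time the derivative within the half-line is two-sided. *)
        show "((\<lambda>s. L s x) has_vector_derivative - laplacian q X (L s) x) (at s)" if "0 < s" for s
        proof -
          have "at s within {0..} = at s"
            using that by (intro at_within_interior) simp
          then show ?thesis
            using deriv[of s x] that Suc.prems has_real_derivative_iff_has_vector_derivative by simp
        qed
        show "(?\<phi> has_vector_derivative ?d s) (at s)" for s
          using d\<phi> has_real_derivative_iff_has_vector_derivative by blast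
        show "norm (- laplacian q X (L s) x) \<le> ?d s" if "0 < s" for s
          using lap[of s] that by simp
      qed
      then show ?thesis using init Suc.prems by simp
    qed
  qed
  have "(\<lambda>n. B * ((?C * t) ^ n / fact n)) \<longlonglongrightarrow> B * 0"
    by (intro tendsto_mult_left summable_LIMSEQ_zero summable_exp_terms)
  then have "\<bar>L t x\<bar> \<le> B * 0"
    by (rule LIMSEQ_le_const) (use iterate[OF t x] in blast)
  then show ?thesis by simp
qed

lemma heat_kernel_unique:
  assumes K: "is_heat_kernel q X x0 K" and K': "is_heat_kernel q X x0 K'"
    and t: "t \<ge> 0" and x: "x \<in> verts X"
  shows "K t x = K' t x"
proof -
  have bdd: "\<exists>B. \<forall>t \<ge> 0. \<forall>x \<in> verts X. \<bar>F t x\<bar> \<le> B" if "is_heat_kernel q X x0 F" for F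
    using that unfolding is_heat_kernel_def by (elim conjE)
  obtain B where B: "\<And>t x. t \<ge> 0 \<Longrightarrow> x \<in> verts X \<Longrightarrow> \<bar>K t x\<bar> \<le> B"
    using bdd[OF K] by blast
  obtain B' where B': "\<And>t x. t \<ge> 0 \<Longrightarrow> x \<in> verts X \<Longrightarrow> \<bar>K' t x\<bar> \<le> B'"
    using bdd[OF K'] by blast
  have heat: "((\<lambda>s. F s x) has_real_derivative - laplacian q X (F t) x) (at t within {0..})"
    if F: "is_heat_kernel q X x0 F" and t: "t \<ge> 0" and x: "x \<in> verts X" for F t x
  proof -
    have "\<forall>t \<ge> 0. \<forall>x \<in> verts X. \<exists>D. ((\<lambda>s. F s x) has_real_derivative D) (at t within {0..})
        \<and> laplacian q X (F t) x + D = 0"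
      using F unfolding is_heat_kernel_def by (rule conjunct1)
    then obtain D where D: "((\<lambda>s. F s x) has_real_derivative D) (at t within {0..})"
      "laplacian q X (F t) x + D = 0" using t x by blast
    from D(2) have "D = - laplacian q X (F t) x" by simp
    with D(1) show ?thesis by simp
  qed
  have "K t x - K' t x = 0"
  proof (rule bounded_heat_solution_zero[where L = "\<lambda>t x. K t x - K' t x" and B = "B + B'"])
    fix t x assume tx: "(t::real) \<ge> 0" "x \<in> verts X"
    have lap_diff: "laplacian q X (\<lambda>x. K t x - K' t x) x = laplacian q X (K t) x - laplacian q X (K' t) x"
      by (simp add: laplacian_eq_adj adj_linear algebra_simps)
    show "((\<lambda>s. K s x - K' s x) has_real_derivative - laplacian q X (\<lambda>x. K t x - K' t x) x)
        (at t within {0..})"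
      using DERIV_diff[OF heat[OF K tx] heat[OF K' tx]] by (simp add: lap_diff)
    show "\<bar>K t x - K' t x\<bar> \<le> B + B'"
      using B[OF tx] B'[OF tx] by linarith
  next
    fix x assume "x \<in> verts X"
    then show "K 0 x - K' 0 x = 0"
      using K K' by (simp add: is_heat_kernel_def)
  qed (use t x in auto)
  then show ?thesis by simp
qed

end

section \<open>The heat kernel as a Bessel series\<close>

theorem theorem1p1:
  fixes q :: nat
    and X :: "('v, 'e) pre_digraph"
    and arev :: "'e \<Rightarrow> 'e"
    and x0 :: 'v
  assumes "bidirected_digraph X arev"
    and "q > 0"
    and "regular_graph X (q + 1)"
    and "x0 \<in> verts X"
  shows "(\<exists>K. is_heat_kernel q X x0 K) \<and>
    (\<forall>K. is_heat_kernel q X x0 K \<longrightarrow>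
      (\<forall>t \<ge> 0. \<forall>x \<in> verts X.
        summable (\<lambda>m. geodesic_coeff q X arev x0 m x * real q powr (- real m / 2)
                        * bessel_I m (2 * sqrt (real q) * t)) \<and>
        K t x = exp (- (real q + 1) * t) *
          (\<Sum>m. geodesic_coeff q X arev x0 m x * real q powr (- real m / 2)
                 * bessel_I m (2 * sqrt (real q) * t))))"
proof -
  interpret bidirected_digraph X arev by (rule assms(1))
  interpret regular_bidirected_digraph X arev q x0
    by unfold_locales (use assms in auto)
  show ?thesis
  proof (intro conjI allI impI ballI)
    show "\<exists>K. is_heat_kernel q X x0 K"
      using heat_kernel_walk_series by blast
  next
    fix K t x
    assume K: "is_heat_kernel q X x0 K" and t: "(t::real) \<ge> 0" and x: "x \<in> verts X"
    note series = bessel_series_sums[OF x, of t]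
    show "summable (\<lambda>m. geod_coeff m x * real q powr (- real m / 2)
        * bessel_I m (2 * sqrt (real q) * t))"
      using series by (rule sums_summable)
    show "K t x = exp (- (real q + 1) * t) * (\<Sum>m. geod_coeff m x * real q powr (- real m / 2)
        * bessel_I m (2 * sqrt (real q) * t))"
      using heat_kernel_unique[OF K heat_kernel_walk_series t x] sums_unique[OF series] by simp
  qed
qed

end
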